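(* Let $\mathsf P,\mathsf H$ be Polish spaces, $D$ a random variable with values in $\mathsf P^N$, $\mathbb P_H$ a probability measure on $\mathsf H$, $\Gamma$ a nonempty compact set, $\eta:\Gamma\to\mathbb R^k$ a function, and $T:\mathsf H\times\mathsf P^N\to\mathbb R^k$, $b:\mathsf H\to(0,\infty)$ measurable functions such that $$c(\gamma,d):=\int_{\mathsf H}b(h)\exp(\langle\eta(\gamma),T(h,d)\rangle)\,\mathbb P_H(dh)\in(0,\infty)\qquad\text{for all }\gamma\in\Gamma,\ d\in\mathsf P^N .$$ Put $\kappa:=\log c$. Assume that there are a finite covering $\mathcal O=\{\mathsf O_1,\dots,\mathsf O_K\}$ of $\Gamma$ by subsets of $\Gamma$ and a constant $C_{\mathcal O}$ such that $\max_{i=1,\dots,K}\sup_{\gamma,\gamma'\in\mathsf O_i}\kappa(\gamma,d)-\kappa(\gamma',d)\le C_{\mathcal O}$ for every $d\in\mathsf P^N$. Assume further that $\mathbb E[c(\gamma,D)]\le1$ for all $\gamma\in\Gamma$. Then for every $\varepsilon>0$, with probability at least $1-\varepsilon$ over $D$, the following holds simultaneously for all $\gamma\in\Gamma$ and all probability measures $\mathbb Q$ on $\mathsf H$ with $\mathbb Q\ll\mathbb P_H$: $$\mathbb Q\left[\langle\eta(\gamma),T(\cdot,D)\rangle+\log b\right]\ \le\ D_{\mathrm{KL}}(\mathbb Q\,\|\,\mathbb P_H)+\log\left(\frac K\varepsilon\right)+C_{\mathcal O}.$$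
   Context: Spaces carry their Borel $\sigma$-algebras and products carry product $\sigma$-algebras. $\mathbb Q[f]=\int f\,d\mathbb Q$, where on the left-hand side the data are held fixed at the realization of $D$. $D_{\mathrm{KL}}(\mathbb Q\|\mathbb P_H)=\mathbb Q[\log f]$ if $\mathbb Q\ll\mathbb P_H$ with density $f$, and $+\infty$ otherwise. $\langle\cdot,\cdot\rangle$ is the Euclidean inner product on $\mathbb R^k$. *)

theory Defs
  imports "HOL-Probability.Probability"
begin

(* Integral with values in [-\<infinity>,\<infinity>]: positive part minus negative part.  The form
   \<infinity> - \<infinity> evaluates to \<infinity> in type ereal. *)
definition ext_integral :: "'a measure \<Rightarrow> ('a \<Rightarrow> real) \<Rightarrow> ereal" where
  "ext_integral M f =
     enn2ereal (\<integral>\<^sup>+ x. ennreal (f x) \<partial>M) - enn2ereal (\<integral>\<^sup>+ x. ennreal (- f x) \<partial>M)"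

(* The library's KL_divergence is a real-valued Bochner integral, hence 0 when the true
   value is \<infinity>.  Since t * ln t is bounded below, the negative part of
   the integral below is finite, so \<infinity> - \<infinity> does not occur for probability measures. *)
definition KL_div :: "'a measure \<Rightarrow> 'a measure \<Rightarrow> ereal" where
  "KL_div Q P =
     (if absolutely_continuous P Q
      then ext_integral Q (\<lambda>h. ln (enn2real (RN_deriv P Q h)))
      else \<infinity>)"

definition part_fun ::
  "'h measure \<Rightarrow> ('h \<Rightarrow> real) \<Rightarrow> ('g \<Rightarrow> real ^ 'k) \<Rightarrow> ('h \<times> 'd \<Rightarrow> real ^ 'k) \<Rightarrow> 'g \<Rightarrow> 'd \<Rightarrow> ennreal"
where
  "part_fun PH b \<eta> T \<gamma> d = (\<integral>\<^sup>+ h. ennreal (b h * exp (\<eta> \<gamma> \<bullet> T (h, d))) \<partial>PH)"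

definition log_part_fun ::
  "'h measure \<Rightarrow> ('h \<Rightarrow> real) \<Rightarrow> ('g \<Rightarrow> real ^ 'k) \<Rightarrow> ('h \<times> 'd \<Rightarrow> real ^ 'k) \<Rightarrow> 'g \<Rightarrow> 'd \<Rightarrow> real"
where
  "log_part_fun PH b \<eta> T \<gamma> d = ln (enn2real (part_fun PH b \<eta> T \<gamma> d))"

end

(* By the Donsker-Varadhan inequality, Q[f] <= KL(Q || P) + log P[exp f] for all Q at once; with
   f = <eta(gamma), T(., D)> + log b the last term is kappa(gamma, D).  The covering compares
   kappa(gamma, D) with kappa at one representative of each nonempty member, at cost C, and
   Markov's inequality with a union bound over the representatives gives
   c(representative, D) <= K / epsilon outside an event of probability at most epsilon. *)

theory Submission
  imports Defs
begin

lemma ext_integral_eq_integral: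
  assumes "integrable M f"
  shows "ext_integral M f = ereal (integral\<^sup>L M f)"
proof -
  obtain r q where "0 \<le> r" "0 \<le> q"
    "(\<integral>\<^sup>+ x. ennreal (f x) \<partial>M) = ennreal r" "(\<integral>\<^sup>+ x. ennreal (- f x) \<partial>M) = ennreal q"
    "integral\<^sup>L M f = r - q"
    using integrableE[OF assms] by metis
  then show ?thesis
    by (simp add: ext_integral_def enn2ereal_ennreal)
qed

text \<open>Domination by an integrable \<open>g\<close> keeps the positive part of \<open>f\<close>
  finite. If the negative part is infinite, the value is a finite number minus \<infinity>, that is
  -\<infinity>; otherwise \<open>f\<close> is integrable and monotonicity applies. The convention
  for \<infinity> - \<infinity> is never reached.\<close>

lemma ext_integral_le_integral:
  assumes f: "f \<in> borel_measurable M" and g: "integrable M g" and le: "AE x in M. f x \<le> g x"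
  shows "ext_integral M f \<le> ereal (integral\<^sup>L M g)"
proof -
  have "(\<integral>\<^sup>+ x. ennreal (f x) \<partial>M) \<le> (\<integral>\<^sup>+ x. ennreal (g x) \<partial>M)"
    using le by (intro nn_integral_mono_AE) (auto intro: ennreal_leI)
  also have "\<dots> < \<infinity>"
    using g integrableE by (metis ennreal_less_top infinity_ennreal_def)
  finally have pos: "(\<integral>\<^sup>+ x. ennreal (f x) \<partial>M) < \<infinity>" .
  show ?thesis
  proof (cases "(\<integral>\<^sup>+ x. ennreal (- f x) \<partial>M) = \<infinity>")
    case True
    obtain r where "(\<integral>\<^sup>+ x. ennreal (f x) \<partial>M) = ennreal r" "0 \<le> r"
      using pos by (cases "\<integral>\<^sup>+ x. ennreal (f x) \<partial>M") auto
    then show ?thesis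
      using True by (simp add: ext_integral_def enn2ereal_ennreal)
  next
    case False
    then have "integrable M f"
      using f pos by (simp add: real_integrable_def)
    then show ?thesis
      using integral_mono_AE[OF _ g le] by (simp add: ext_integral_eq_integral)
  qed
qed

text \<open>Against \<open>P\<close> the integrand becomes t * (- ln t) with t =
  \<open>\<phi> x\<close>, and ln u \<le> u - 1 at u = 1/t bounds it by 1 - t \<le> 1. This makes
  the negative part in the Kullback-Leibler integral finite.\<close>

lemma nn_integral_neg_ln_density_le:
  assumes "prob_space P" and [measurable]: "\<phi> \<in> borel_measurable P"
    and nonneg: "\<And>x. 0 \<le> \<phi> x"
  shows "(\<integral>\<^sup>+ x. ennreal (- ln (\<phi> x)) \<partial>density P (\<lambda>x. ennreal (\<phi> x))) \<le> 1"
proof -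
  interpret prob_space P by fact
  have "ennreal (\<phi> x) * ennreal (- ln (\<phi> x)) \<le> 1" for x
  proof (cases "\<phi> x = 0")
    case False
    then have p: "0 < \<phi> x"
      using nonneg[of x] by simp
    have "- ln (\<phi> x) = ln (1 / \<phi> x)"
      using p by (simp add: ln_div)
    also have "\<dots> \<le> 1 / \<phi> x - 1"
      using p by (intro ln_le_minus_one) simp
    finally have "\<phi> x * (- ln (\<phi> x)) \<le> \<phi> x * (1 / \<phi> x - 1)"
      using p by (intro mult_left_mono) auto
    also have "\<dots> \<le> 1"
      using p by (simp add: field_simps)
    finally have "ennreal (\<phi> x * (- ln (\<phi> x))) \<le> 1"
      by (simp only: ennreal_le_1)
    then show ?thesis
      using nonneg[of x] by (simp only: ennreal_mult')
  qed simp
  then have "(\<integral>\<^sup>+ x. ennreal (\<phi> x) * ennreal (- ln (\<phi> x)) \<partial>P) \<le> (\<integral>\<^sup>+ x. 1 \<partial>P)"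
    by (intro nn_integral_mono) auto
  then show ?thesis
    by (simp add: nn_integral_density emeasure_space_1)
qed

text \<open>Write \<phi> = dQ/dP and z = P[exp f]. The ratio r = exp f / \<phi> has Q-integral at
  most z, and ln u \<le> u - 1 at u = r/z gives f \<le> ln \<phi> + ln z + (r/z - 1) Q-almost
  everywhere. Integrating against \<open>Q\<close> removes the last bracket. Only an integrable
  upper bound of \<open>f\<close> enters, so \<open>f\<close> itself may fail to be
  Q-integrable.\<close>

lemma Donsker_Varadhan_le:
  assumes P: "prob_space P" and Q: "prob_space Q" and sets_eq: "sets Q = sets P"
    and ac: "absolutely_continuous P Q"
    and f[measurable]: "f \<in> borel_measurable P"
    and pos: "0 < (\<integral>\<^sup>+ x. ennreal (exp (f x)) \<partial>P)"
    and fin: "(\<integral>\<^sup>+ x. ennreal (exp (f x)) \<partial>P) < \<infinity>"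
  shows "ext_integral Q f
    \<le> KL_div Q P + ereal (ln (enn2real (\<integral>\<^sup>+ x. ennreal (exp (f x)) \<partial>P)))"
proof -
  interpret P: prob_space P by fact
  interpret Q: prob_space Q by fact
  define \<phi> where "\<phi> = (\<lambda>x. enn2real (RN_deriv P Q x))"
  define L where "L = (\<lambda>x. ln (\<phi> x))"
  define z where "z = enn2real (\<integral>\<^sup>+ x. ennreal (exp (f x)) \<partial>P)"
  have \<phi>[measurable]: "\<phi> \<in> borel_measurable P"
    unfolding \<phi>_def by measurable
  have nonneg: "0 \<le> \<phi> x" for x
    by (simp add: \<phi>_def)
  have z: "0 < z" "(\<integral>\<^sup>+ x. ennreal (exp (f x)) \<partial>P) = ennreal z"
    using pos fin by (auto simp: z_def enn2real_positive_iff)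
  \<comment> \<open>\<open>enn2real\<close> sends \<infinity> to 0, so the real-valued
    \<open>\<phi>\<close> represents the density only where the derivative is finite;
    \<sigma>-finiteness of \<open>Q\<close> makes this almost everywhere.\<close>
  have "AE x in P. RN_deriv P Q x \<noteq> \<infinity>"
    using P.RN_deriv_finite[OF Q.sigma_finite_measure_axioms ac] sets_eq by simp
  then have "AE x in P. RN_deriv P Q x = ennreal (\<phi> x)"
    by eventually_elim (simp add: \<phi>_def less_top)
  then have "density P (RN_deriv P Q) = density P (\<lambda>x. ennreal (\<phi> x))"
    by (intro density_cong) auto
  then have Q_eq: "Q = density P (\<lambda>x. ennreal (\<phi> x))"
    using P.density_RN_deriv[OF ac] sets_eq by simp
  have meas_Q: "g \<in> borel_measurable Q" if "g \<in> borel_measurable P" for g :: "_ \<Rightarrow> real"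
    using that by (simp add: Q_eq)
  have \<phi>_pos: "AE x in Q. 0 < \<phi> x"
    unfolding Q_eq by (subst AE_density) auto
  have KL: "KL_div Q P = ext_integral Q L"
    using ac by (simp add: KL_div_def L_def \<phi>_def)
  have "(\<integral>\<^sup>+ x. ennreal (- L x) \<partial>Q) \<le> 1"
    unfolding L_def Q_eq by (rule nn_integral_neg_ln_density_le[OF P \<phi> nonneg])
  then have L_neg: "(\<integral>\<^sup>+ x. ennreal (- L x) \<partial>Q) \<noteq> \<infinity>"
    by (auto simp: top_unique)
  show ?thesis
  \<comment> \<open>An infinite positive part of \<open>L\<close> makes the divergence, hence the
    right-hand side, \<infinity>. Otherwise both parts are finite and \<open>L\<close> is
    Q-integrable.\<close>
  proof (cases "(\<integral>\<^sup>+ x. ennreal (L x) \<partial>Q) = \<infinity>")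
    case True
    then have "KL_div Q P = \<infinity>"
      by (simp add: KL ext_integral_def)
    then show ?thesis
      by simp
  next
    case False
    have L: "integrable Q L"
      using False L_neg meas_Q[of L] by (simp add: real_integrable_def L_def)
    define r where "r = (\<lambda>x. exp (f x) / \<phi> x)"
    have r[measurable]: "r \<in> borel_measurable P"
      unfolding r_def by measurable
    have r_nonneg: "0 \<le> r x" for x
      by (simp add: r_def nonneg)
    have "(\<integral>\<^sup>+ x. ennreal (r x) \<partial>Q) = (\<integral>\<^sup>+ x. ennreal (\<phi> x) * ennreal (r x) \<partial>P)"
      unfolding Q_eq by (simp add: nn_integral_density)
    \<comment> \<open>Only an inequality: where \<open>\<phi>\<close> vanishes, division by 0 gives
      \<open>r x = 0\<close>, so the product is 0 while \<open>exp (f x)\<close> is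
      positive.\<close>
    also have "\<dots> \<le> (\<integral>\<^sup>+ x. ennreal (exp (f x)) \<partial>P)"
      by (intro nn_integral_mono)
        (auto simp: r_def ennreal_mult'[symmetric] nonneg intro!: ennreal_leI)
    finally have r_le: "(\<integral>\<^sup>+ x. ennreal (r x) \<partial>Q) \<le> ennreal z"
      by (simp add: z)
    have r_int: "integrable Q r"
      using r_le r_nonneg meas_Q[OF r]
      by (intro integrableI_nonneg) (auto intro: le_less_trans)
    have r_lint: "integral\<^sup>L Q r \<le> z"
      using r_le z(1) nn_integral_eq_integral[OF r_int] r_nonneg by simp
    \<comment> \<open>The integrable majorant of \<open>f\<close>; since \<open>r\<close> has
      Q-integral at most \<open>z\<close>, the term \<open>r x / z - 1\<close> contributes at most 0
      to its integral.\<close>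
    define g where "g = (\<lambda>x. L x + (r x / z - 1 + ln z))"
    have g: "integrable Q g"
      unfolding g_def using L r_int by simp
    have "AE x in Q. f x \<le> g x"
      using \<phi>_pos
    proof eventually_elim
      case (elim x)
      have "f x - L x - ln z = ln (r x / z)"
        using elim z(1) by (simp add: r_def L_def ln_div ln_mult)
      also have "\<dots> \<le> r x / z - 1"
        using elim z(1) by (intro ln_le_minus_one) (simp add: r_def)
      finally show ?case
        by (simp add: g_def)
    qed
    then have "ext_integral Q f \<le> ereal (integral\<^sup>L Q g)"
      using meas_Q[OF f] g by (intro ext_integral_le_integral)
    also have "integral\<^sup>L Q g = integral\<^sup>L Q L + (integral\<^sup>L Q r / z - 1 + ln z)"
      unfolding g_def using L r_int by (simp add: Q.prob_space)
    also have "\<dots> \<le> integral\<^sup>L Q L + ln z"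
      using r_lint z(1) by (simp add: field_simps)
    finally show ?thesis
      using L by (simp add: KL ext_integral_eq_integral z_def)
  qed
qed

text \<open>Markov's inequality at level K/\<epsilon> gives each bad event probability at most
  \<epsilon>/K, and at most K of them are united. Allowing \<open>card I \<le> K\<close> lets empty
  members of a covering be dropped without changing the level.\<close>

lemma prob_all_le_ge:
  fixes g :: "'i \<Rightarrow> 'a \<Rightarrow> ennreal" and \<epsilon> :: real
  assumes "prob_space M" and I: "finite I" "card I \<le> K" and "0 < \<epsilon>" "0 < K"
    and [measurable]: "\<And>i. i \<in> I \<Longrightarrow> g i \<in> borel_measurable M"
    and g: "\<And>i. i \<in> I \<Longrightarrow> (\<integral>\<^sup>+ \<omega>. g i \<omega> \<partial>M) \<le> 1"
  shows "1 - \<epsilon> \<le> measure M {\<omega> \<in> space M. \<forall>i\<in>I. g i \<omega> \<le> ennreal (real K / \<epsilon>)}"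
proof -
  interpret prob_space M by fact
  define B where "B = (\<lambda>i. {\<omega> \<in> space M. ennreal (real K / \<epsilon>) < g i \<omega>})"
  have B[measurable]: "B i \<in> sets M" if "i \<in> I" for i
    using that unfolding B_def by measurable
  have B_le: "prob (B i) \<le> \<epsilon> / K" if i: "i \<in> I" for i
  proof -
    \<comment> \<open>Rescaling by \<epsilon>/K moves the threshold to 1, the form in which Markov's
      inequality is applied.\<close>
    have "emeasure M (B i) \<le> emeasure M {\<omega> \<in> space M. 1 \<le> ennreal (\<epsilon> / K) * g i \<omega>}"
    proof (rule emeasure_mono)
      show "B i \<subseteq> {\<omega> \<in> space M. 1 \<le> ennreal (\<epsilon> / K) * g i \<omega>}"
      proof safe
        fix \<omega> assume "\<omega> \<in> B i"
        then show "\<omega> \<in> space M" and "1 \<le> ennreal (\<epsilon> / K) * g i \<omega>"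
          using mult_left_mono[of "ennreal (real K / \<epsilon>)" "g i \<omega>" "ennreal (\<epsilon> / K)"] assms(4,5)
          by (auto simp: B_def ennreal_mult'[symmetric])
      qed
    qed (use i in measurable)
    also have "\<dots> \<le> ennreal (\<epsilon> / K) * (\<integral>\<^sup>+ \<omega>. g i \<omega> * indicator (space M) \<omega> \<partial>M)"
      using nn_integral_Markov_inequality[of "g i" "space M" M "ennreal (\<epsilon> / K)"] i
      by (simp add: set_eq_iff)
    also have "(\<integral>\<^sup>+ \<omega>. g i \<omega> * indicator (space M) \<omega> \<partial>M) = (\<integral>\<^sup>+ \<omega>. g i \<omega> \<partial>M)"
      by (intro nn_integral_cong) simp
    also have "ennreal (\<epsilon> / K) * \<dots> \<le> ennreal (\<epsilon> / K)"
      using mult_left_mono[OF g[OF i], of "ennreal (\<epsilon> / K)"] by simp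
    finally show ?thesis
      using assms(4,5) by (simp add: emeasure_eq_measure)
  qed
  have "prob (\<Union>i\<in>I. B i) \<le> (\<Sum>i\<in>I. prob (B i))"
    using I B by (intro finite_measure_subadditive_finite) auto
  also have "\<dots> \<le> (\<Sum>i\<in>I. \<epsilon> / K)"
    using B_le by (rule sum_mono)
  also have "\<dots> \<le> \<epsilon>"
    using I(2) assms(4,5) by (simp add: field_simps)
  finally have "1 - \<epsilon> \<le> 1 - prob (\<Union>i\<in>I. B i)"
    by simp
  also have "\<dots> = prob (space M - (\<Union>i\<in>I. B i))"
    using I B by (subst prob_compl) auto
  also have "space M - (\<Union>i\<in>I. B i)
      = {\<omega> \<in> space M. \<forall>i\<in>I. g i \<omega> \<le> ennreal (real K / \<epsilon>)}"
    by (auto simp: B_def not_less)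
  finally show ?thesis .
qed


theorem mainTheorem2:
  fixes M :: "'w measure"
    and N K :: nat
    and D :: "'w \<Rightarrow> nat \<Rightarrow> 'p::polish_space"
    and PH :: "'h::polish_space measure"
    and \<Gamma> :: "'g::topological_space set"
    and \<eta> :: "'g \<Rightarrow> real ^ 'k"
    and T :: "'h \<times> (nat \<Rightarrow> 'p) \<Rightarrow> real ^ 'k"
    and b :: "'h \<Rightarrow> real"
    and Oc :: "nat \<Rightarrow> 'g set"
    and C :: real
    and \<epsilon> :: real
  assumes "prob_space M"
    and "D \<in> measurable M (\<Pi>\<^sub>M i\<in>{..<N}. borel)"
    and "prob_space PH" and "sets PH = sets borel"
    and "compact \<Gamma>" and "\<Gamma> \<noteq> {}"
    and "T \<in> borel_measurable (borel \<Otimes>\<^sub>M (\<Pi>\<^sub>M i\<in>{..<N}. borel))"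
    and "b \<in> borel_measurable borel" and "\<And>h. b h > 0"
    and "\<And>\<gamma> d. \<gamma> \<in> \<Gamma> \<Longrightarrow> d \<in> space (\<Pi>\<^sub>M i\<in>{..<N}. (borel :: 'p measure)) \<Longrightarrow>
           0 < part_fun PH b \<eta> T \<gamma> d \<and> part_fun PH b \<eta> T \<gamma> d < \<infinity>"
    and "\<And>i. i \<in> {1..K} \<Longrightarrow> Oc i \<subseteq> \<Gamma>" and "\<Gamma> \<subseteq> (\<Union>i\<in>{1..K}. Oc i)"
    and "\<And>d. d \<in> space (\<Pi>\<^sub>M i\<in>{..<N}. (borel :: 'p measure)) \<Longrightarrow>
           (MAX i\<in>{1..K}. SUP (\<gamma>, \<gamma>')\<in>Oc i \<times> Oc i.
              ereal (log_part_fun PH b \<eta> T \<gamma> d - log_part_fun PH b \<eta> T \<gamma>' d)) \<le> ereal C"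
    and "\<And>\<gamma>. \<gamma> \<in> \<Gamma> \<Longrightarrow> (\<integral>\<^sup>+ \<omega>. part_fun PH b \<eta> T \<gamma> (D \<omega>) \<partial>M) \<le> 1"
    and "\<epsilon> > 0"
  shows "\<exists>A \<in> sets M. measure M A \<ge> 1 - \<epsilon> \<and>
           (\<forall>\<omega>\<in>A. \<forall>\<gamma>\<in>\<Gamma>. \<forall>Q :: 'h measure.
              prob_space Q \<longrightarrow> sets Q = sets borel \<longrightarrow> absolutely_continuous PH Q \<longrightarrow>
              ext_integral Q (\<lambda>h. \<eta> \<gamma> \<bullet> T (h, D \<omega>) + ln (b h))
                \<le> KL_div Q PH + ereal (ln (real K / \<epsilon>)) + ereal C)"
proof -
  let ?S = "\<Pi>\<^sub>M i\<in>{..<N}. (borel :: 'p measure)"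
  let ?c = "part_fun PH b \<eta> T"
  let ?\<kappa> = "log_part_fun PH b \<eta> T"
  interpret PH: prob_space PH by fact
  note [measurable] = assms(2,7,8)
  note [measurable_cong] = assms(4)
  have D_space: "D \<omega> \<in> space ?S" if "\<omega> \<in> space M" for \<omega>
    using that assms(2) by (rule measurable_space[rotated])
  \<comment> \<open>Joint measurability of the integrand passes to the integral over
    \<open>h\<close>; this makes the set \<open>A\<close> below an event.\<close>
  have "(\<lambda>d. \<integral>\<^sup>+ h. ennreal (b h * exp (\<eta> \<gamma> \<bullet> T (h, d))) \<partial>PH) \<in> borel_measurable ?S" for \<gamma>
    by measurable
  then have c_meas[measurable]: "?c \<gamma> \<in> borel_measurable ?S" for \<gamma>
    by (simp add: part_fun_def[abs_def])
  \<comment> \<open>An empty family cannot cover the nonempty \<Gamma>.\<close>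
  have "0 < K"
    using assms(6,12) by (cases K) auto
  \<comment> \<open>Empty members have no representative and are left out.\<close>
  define I where "I = {i \<in> {1..K}. Oc i \<noteq> {}}"
  define rep where "rep = (\<lambda>i. SOME \<gamma>. \<gamma> \<in> Oc i)"
  have rep: "rep i \<in> Oc i" "rep i \<in> \<Gamma>" if "i \<in> I" for i
  proof -
    show *: "rep i \<in> Oc i"
      using that unfolding rep_def I_def by (auto intro: someI)
    show "rep i \<in> \<Gamma>"
      using that * assms(11)[of i] by (auto simp: I_def)
  qed
  \<comment> \<open>The event mentions only the finitely many representatives, neither \<gamma> nor
    \<open>Q\<close>, so it serves all of them simultaneously.\<close>
  define A where "A = {\<omega> \<in> space M. \<forall>i\<in>I. ?c (rep i) (D \<omega>) \<le> ennreal (real K / \<epsilon>)}"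
  have [simp]: "finite I"
    by (simp add: I_def)
  have "A \<in> sets M"
    unfolding A_def by measurable
  moreover have "1 - \<epsilon> \<le> measure M A"
    unfolding A_def
  proof (rule prob_all_le_ge[OF assms(1)])
    show "card I \<le> K"
      using card_mono[of "{1..K}" I] by (simp add: I_def subset_iff)
    show "(\<integral>\<^sup>+ \<omega>. ?c (rep i) (D \<omega>) \<partial>M) \<le> 1" if "i \<in> I" for i
      using assms(14) rep(2)[OF that] .
  qed (use \<open>0 < K\<close> assms(15) in auto)
  moreover have "ext_integral Q (\<lambda>h. \<eta> \<gamma> \<bullet> T (h, D \<omega>) + ln (b h))
      \<le> KL_div Q PH + ereal (ln (real K / \<epsilon>)) + ereal C"
    if \<omega>: "\<omega> \<in> A" and \<gamma>: "\<gamma> \<in> \<Gamma>"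
      and Q: "prob_space Q" "sets Q = sets borel" "absolutely_continuous PH Q"
    for \<omega> \<gamma> and Q :: "'h measure"
  proof -
    have d: "D \<omega> \<in> space ?S"
      using \<omega> by (intro D_space) (simp add: A_def)
    let ?f = "\<lambda>h. \<eta> \<gamma> \<bullet> T (h, D \<omega>) + ln (b h)"
    \<comment> \<open>Positivity of \<open>b\<close> gives exp (ln b) = b, which identifies the
      exponential moment of \<open>?f\<close> with the partition function.\<close>
    have exp_f: "exp (?f h) = b h * exp (\<eta> \<gamma> \<bullet> T (h, D \<omega>))" for h
      using assms(9)[of h] by (simp add: exp_add)
    have f_meas: "?f \<in> borel_measurable PH"
      using d by measurable
    have Z: "(\<integral>\<^sup>+ h. ennreal (exp (?f h)) \<partial>PH) = ?c \<gamma> (D \<omega>)"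
      by (simp only: exp_f part_fun_def)
    have DV: "ext_integral Q ?f \<le> KL_div Q PH + ereal (?\<kappa> \<gamma> (D \<omega>))"
      using Donsker_Varadhan_le[OF assms(3) Q(1) _ Q(3) f_meas] Q(2) assms(4) assms(10)[OF \<gamma> d]
      unfolding Z log_part_fun_def by simp
    obtain i where i: "i \<in> {1..K}" "\<gamma> \<in> Oc i"
      using \<gamma> assms(12) by auto
    then have iI: "i \<in> I"
      by (auto simp: I_def)
    \<comment> \<open>The oscillation bound is used at the pair (\<gamma>, \<open>rep i\<close>),
      whose two entries both lie in \<open>Oc i\<close>.\<close>
    have "ereal (?\<kappa> \<gamma> (D \<omega>) - ?\<kappa> (rep i) (D \<omega>))
        \<le> (SUP (\<gamma>, \<gamma>')\<in>Oc i \<times> Oc i. ereal (?\<kappa> \<gamma> (D \<omega>) - ?\<kappa> \<gamma>' (D \<omega>)))"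
      using i rep(1)[OF iI] by (intro SUP_upper2[of "(\<gamma>, rep i)"]) auto
    also have "\<dots> \<le> (MAX i\<in>{1..K}. SUP (\<gamma>, \<gamma>')\<in>Oc i \<times> Oc i.
        ereal (?\<kappa> \<gamma> (D \<omega>) - ?\<kappa> \<gamma>' (D \<omega>)))"
      using i by (intro Max_ge) auto
    also have "\<dots> \<le> ereal C"
      using assms(13)[OF d] .
    finally have "?\<kappa> \<gamma> (D \<omega>) \<le> ?\<kappa> (rep i) (D \<omega>) + C"
      by simp
    moreover have "?\<kappa> (rep i) (D \<omega>) \<le> ln (real K / \<epsilon>)"
    proof -
      have "0 < enn2real (?c (rep i) (D \<omega>))"
        using assms(10)[OF rep(2)[OF iI] d] by (simp add: enn2real_positive_iff)
      moreover have "enn2real (?c (rep i) (D \<omega>)) \<le> real K / \<epsilon>"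
        using \<omega> iI assms(15) by (intro enn2real_leI) (auto simp: A_def)
      ultimately show ?thesis
        by (simp add: log_part_fun_def)
    qed
    ultimately have "?\<kappa> \<gamma> (D \<omega>) \<le> ln (real K / \<epsilon>) + C"
      by simp
    then have "ext_integral Q ?f \<le> KL_div Q PH + ereal (ln (real K / \<epsilon>) + C)"
      using DV by (meson add_left_mono ereal_less_eq(3) order_trans)
    then show ?thesis
      by (simp add: add.assoc)
  qed
  ultimately show ?thesis
    by blast
qed

end
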